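(* Let $d$ be a positive integer with $d \equiv 0 \pmod{4}$. Then there exist a radial Schwartz function $f:\mathbb{R}^d \to \mathbb{R}$, radial Schwartz functions $f_+, f_-$ on $\mathbb{R}^d$, and an $n \in \mathbb{N}$ such that \begin{itemize} \item $f(x) = f_+(x) + f_-(x)$ and $\widehat{f}(x) = (-i)^{-\frac{d}{2}}\big(f_+(x) - f_-(x)\big)$ for all $x\in\mathbb{R}^d$; \item $f(\sqrt{2n}) = 0$ and $f'(\sqrt{2n}) \neq 0$; \item $f(\sqrt{2m}) = f'(\sqrt{2m}) = 0$ for all integers $m > n$. \end{itemize}
   Context: The Fourier transform of an integrable $g:\mathbb{R}^d\to\mathbb{C}$ is $\widehat{g}(y) = \int_{\mathbb{R}^d} g(x) e^{-2\pi i \langle x,y\rangle}\,dx$. A Schwartz function is a smooth function all of whose derivatives decay faster than any inverse power of $|x|$. For a radial function $f$ on $\mathbb{R}^d$, $f(r)$ denotes its value at any $x$ with $|x| = r$, and $f'(r)$ is the derivative of this radial profile $r\mapsto f(r)$. *)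

theory Defs
  imports "HOL-Analysis.Analysis"
begin

text \<open>
  The list order is immaterial for smooth functions: the head of the list is the variable
  differentiated last.
\<close>

primrec iter_partial ::
    "'d list \<Rightarrow> (real ^ 'd \<Rightarrow> 'b::real_normed_vector) \<Rightarrow> real ^ 'd \<Rightarrow> 'b" where
  "iter_partial [] f = f"
| "iter_partial (i # is) f =
     (\<lambda>x. frechet_derivative (iter_partial is f) (at x) (axis i 1))"

text \<open>
  Total differentiability of every iterated partial derivative makes all of them continuous,
  so this is \<open>C\<^sup>\<infinity>\<close>; it also ensures that \<^const>\<open>frechet_derivative\<close> above
  is the actual derivative and never an arbitrary value.
\<close>

definition smooth_function :: "(real ^ 'd \<Rightarrow> 'b::real_normed_vector) \<Rightarrow> bool" where
  "smooth_function f \<longleftrightarrow> (\<forall>is x. iter_partial is f differentiable (at x))"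

definition schwartz :: "(real ^ 'd \<Rightarrow> 'b::real_normed_vector) \<Rightarrow> bool" where
  "schwartz f \<longleftrightarrow> smooth_function f \<and>
     (\<forall>is (k::nat). ((\<lambda>x. norm x ^ k *\<^sub>R iter_partial is f x) \<longlongrightarrow> 0) at_infinity)"

definition radial :: "(real ^ 'd \<Rightarrow> 'b) \<Rightarrow> bool" where
  "radial f \<longleftrightarrow> (\<forall>x y. norm x = norm y \<longrightarrow> f x = f y)"

text \<open>Only meaningful for radial \<open>f\<close> and \<open>r \<ge> 0\<close>.\<close>

definition radial_profile :: "(real ^ 'd \<Rightarrow> 'b) \<Rightarrow> real \<Rightarrow> 'b" where
  "radial_profile f r = f (SOME x. norm x = r)"

lemma radial_profile_norm:
  "radial f \<Longrightarrow> radial_profile f (norm x) = f x"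
  unfolding radial_def radial_profile_def by (metis (mono_tags, lifting) someI)

text \<open>
  The profile lives on \<open>[0, \<infinity>)\<close>; the derivative is therefore one-sided at \<open>0\<close>, and the
  ordinary two-sided derivative at every \<open>r > 0\<close>.
\<close>

definition radial_deriv :: "(real ^ 'd \<Rightarrow> 'b::real_normed_vector) \<Rightarrow> real \<Rightarrow> 'b" where
  "radial_deriv f r = vector_derivative (radial_profile f) (at r within {0..})"

definition fourier_transform :: "(real ^ 'd \<Rightarrow> complex) \<Rightarrow> real ^ 'd \<Rightarrow> complex" where
  "fourier_transform g y =
     (LINT x|lborel. g x * exp (- 2 * complex_of_real pi * \<i> * complex_of_real (x \<bullet> y)))"

end

theory Submission
  imports Defs "HOL-Probability.Characteristic_Functions" "HOL-Complex_Analysis.Conformal_Mappings"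
begin

text \<open>
  The parts \<open>f\<^sub>+\<close> and \<open>f\<^sub>-\<close> are not constrained further, so they can be read off from any \<open>f\<close>
  whose Fourier transform is again radial and Schwartz. With \<open>t = |x|\<^sup>2\<close> we take
  \<open>f(x) = exp (- \<pi> t) (1 - cos (\<pi> (t - 2))) / (t - 2)\<close>, which has a simple zero at \<open>t = 2\<close> and
  double zeros at all other even \<open>t\<close>. It is the imaginary part of the superposition
  \<open>W(t) = \<integral>\<^sub>0\<^sup>\<pi> exp (- 2 i s) exp (- (\<pi> - i s) t) ds\<close> of complex Gaussians. The transform of a
  Gaussian with complex rate follows from the real case by analytic continuation, so the transform of
  \<open>f\<close> is the imaginary part of a superposition of the same kind. Such superpositions are Schwartz
  because every \<open>t\<close>-derivative is again one and decays exponentially.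
\<close>

subsection \<open>Schwartz functions of the squared norm\<close>

text \<open>Smoothness is carried by an explicit sequence \<open>D\<close> of successive
  derivatives. They exist on the whole line, so \<open>t = |x|^2 = 0\<close> is no boundary point,
  but decay is asked only at \<open>+\<infinity>\<close> because the argument will be a squared
  norm.\<close>

definition schwartz_profile :: "(real \<Rightarrow> 'b::real_normed_vector) \<Rightarrow> bool" where
  "schwartz_profile G \<longleftrightarrow> (\<exists>D :: nat \<Rightarrow> real \<Rightarrow> 'b. D 0 = G \<and>
     (\<forall>k t. (D k has_vector_derivative D (Suc k) t) (at t)) \<and>
     (\<forall>k m. ((\<lambda>t. t ^ m *\<^sub>R D k t) \<longlongrightarrow> 0) at_top))"

section \<open>Closure properties of Schwartz profiles\<close>

lemma schwartz_profile_decay: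
  "schwartz_profile G \<Longrightarrow> ((\<lambda>t. t ^ m *\<^sub>R G t) \<longlongrightarrow> 0) at_top"
  unfolding schwartz_profile_def by blast

lemma schwartz_profile_derivative:
  assumes "schwartz_profile G"
  shows "\<exists>G'. schwartz_profile G' \<and> (\<forall>t. (G has_vector_derivative G' t) (at t))"
proof -
  from assms obtain D :: "nat \<Rightarrow> real \<Rightarrow> 'a" where D: "D 0 = G"
    "\<And>k t. (D k has_vector_derivative D (Suc k) t) (at t)"
    "\<And>k m. ((\<lambda>t. t ^ m *\<^sub>R D k t) \<longlongrightarrow> 0) at_top"
    unfolding schwartz_profile_def by blast
  have "schwartz_profile (D 1)"
    unfolding schwartz_profile_def
    by (rule exI[of _ "\<lambda>k. D (Suc k)"]) (use D in auto)
  with D(1) D(2)[of 0] show ?thesis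
    by (intro exI[of _ "D 1"]) auto
qed

lemma schwartz_profile_0: "schwartz_profile (\<lambda>_. 0)"
  unfolding schwartz_profile_def by (rule exI[of _ "\<lambda>_ _. 0"]) auto

lemma schwartz_profile_add:
  assumes "schwartz_profile G" "schwartz_profile H"
  shows "schwartz_profile (\<lambda>t. G t + H t)"
proof -
  from assms(1) obtain D :: "nat \<Rightarrow> real \<Rightarrow> 'a" where D: "D 0 = G"
    "\<And>k t. (D k has_vector_derivative D (Suc k) t) (at t)"
    "\<And>k m. ((\<lambda>t. t ^ m *\<^sub>R D k t) \<longlongrightarrow> 0) at_top"
    unfolding schwartz_profile_def by blast
  from assms(2) obtain E :: "nat \<Rightarrow> real \<Rightarrow> 'a" where E: "E 0 = H"
    "\<And>k t. (E k has_vector_derivative E (Suc k) t) (at t)"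
    "\<And>k m. ((\<lambda>t. t ^ m *\<^sub>R E k t) \<longlongrightarrow> 0) at_top"
    unfolding schwartz_profile_def by blast
  have "((\<lambda>t. t ^ m *\<^sub>R (D k t + E k t)) \<longlongrightarrow> 0) at_top" for k m
    using tendsto_add[OF D(3) E(3), of m k m k] by (simp add: scaleR_add_right)
  then show ?thesis
    unfolding schwartz_profile_def
    by (intro exI[of _ "\<lambda>k t. D k t + E k t"])
       (auto simp: D(1) E(1) intro!: has_vector_derivative_add D(2) E(2))
qed

lemma schwartz_profile_bounded_linear:
  assumes "bounded_linear h" "schwartz_profile G"
  shows "schwartz_profile (\<lambda>t. h (G t))"
proof -
  interpret h: bounded_linear h by fact
  from assms(2) obtain D :: "nat \<Rightarrow> real \<Rightarrow> 'a" where D: "D 0 = G"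
    "\<And>k t. (D k has_vector_derivative D (Suc k) t) (at t)"
    "\<And>k m. ((\<lambda>t. t ^ m *\<^sub>R D k t) \<longlongrightarrow> 0) at_top"
    unfolding schwartz_profile_def by blast
  have "((\<lambda>t. t ^ m *\<^sub>R h (D k t)) \<longlongrightarrow> 0) at_top" for k m
    using h.tendsto_zero[OF D(3)[of m k]] by (simp add: h.scaleR)
  then show ?thesis
    unfolding schwartz_profile_def
    by (intro exI[of _ "\<lambda>k t. h (D k t)"])
       (auto simp: D(1) intro!: h.has_vector_derivative D(2))
qed

text \<open>
  A class of functions that contains \<open>G(|x|\<^sup>2)\<close> and is closed under partial derivatives, all of whose
  members decay rapidly.
\<close>

inductive coord_profile :: "(real ^ 'd \<Rightarrow> 'b::real_normed_vector) \<Rightarrow> bool" where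
  profile: "schwartz_profile G \<Longrightarrow> coord_profile (\<lambda>x. G (x \<bullet> x))"
| add: "coord_profile g \<Longrightarrow> coord_profile h \<Longrightarrow> coord_profile (\<lambda>x. g x + h x)"
| coord: "coord_profile g \<Longrightarrow> coord_profile (\<lambda>x. (x $ i) *\<^sub>R g x)"

text \<open>In the base case \<open>|x|^k \<le> (x \<bullet> x)^k\<close> for
  \<open>|x| \<ge> 1\<close> reduces the claim to the decay of the profile. A coordinate factor
  costs one power of the norm, so the induction runs over all \<open>k\<close>
  simultaneously.\<close>

lemma coord_profile_decay:
  "coord_profile g \<Longrightarrow> ((\<lambda>x. norm x ^ k *\<^sub>R g x) \<longlongrightarrow> 0) at_infinity"
proof (induction arbitrary: k rule: coord_profile.induct)
  case (profile G)
  have lim: "filterlim (\<lambda>x :: real ^ 'a. x \<bullet> x) at_top at_infinity"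
    unfolding power2_norm_eq_inner[symmetric]
    by (intro filterlim_pow_at_top filterlim_norm_at_top) simp
  have "((\<lambda>x :: real ^ 'a. (x \<bullet> x) ^ k *\<^sub>R G (x \<bullet> x)) \<longlongrightarrow> 0) at_infinity"
    using filterlim_compose[OF schwartz_profile_decay[OF profile] lim] .
  moreover have "\<forall>\<^sub>F x :: real ^ 'a in at_infinity.
      norm (norm x ^ k *\<^sub>R G (x \<bullet> x)) \<le> norm ((x \<bullet> x) ^ k *\<^sub>R G (x \<bullet> x)) * 1"
    unfolding eventually_at_infinity
  proof (intro exI[of _ 1] allI impI)
    fix x :: "real ^ 'a" assume "1 \<le> norm x"
    then have "norm x ^ k \<le> norm x ^ (2 * k)"
      by (intro power_increasing) auto
    also have "\<dots> = (x \<bullet> x) ^ k"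
      by (simp add: power_mult power2_norm_eq_inner)
    finally show "norm (norm x ^ k *\<^sub>R G (x \<bullet> x)) \<le> norm ((x \<bullet> x) ^ k *\<^sub>R G (x \<bullet> x)) * 1"
      by (simp add: mult_right_mono)
  qed
  ultimately show ?case
    by (rule tendsto_0_le)
next
  case (add g h)
  from tendsto_add[OF add.IH, of k k] show ?case
    by (simp add: scaleR_add_right)
next
  case (coord g i)
  have "norm (norm x ^ k *\<^sub>R (x $ i) *\<^sub>R g x) \<le> norm (norm x ^ Suc k *\<^sub>R g x) * 1" for x :: "real ^ 'a"
  proof -
    have "norm (norm x ^ k *\<^sub>R (x $ i) *\<^sub>R g x) = \<bar>x $ i\<bar> * (norm x ^ k * norm (g x))"
      by (simp add: abs_mult)
    also have "\<dots> \<le> norm x * (norm x ^ k * norm (g x))"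
      by (intro mult_right_mono component_le_norm_cart) simp
    finally show ?thesis
      by simp
  qed
  then show ?case
    by (intro tendsto_0_le[OF coord.IH[of "Suc k"], where K = 1] always_eventually allI)
qed

text \<open>The chain rule turns \<open>G (x \<bullet> x)\<close> into
  \<open>2 x_i G' (x \<bullet> x)\<close>, which is again a coordinate times a profile; sums and
  coordinate factors follow from the sum and product rules.\<close>

lemma coord_profile_derivative:
  fixes g :: "real ^ 'd \<Rightarrow> 'b::real_normed_vector"
  assumes "coord_profile g"
  shows "\<exists>g'. (\<forall>x. (g has_derivative g' x) (at x)) \<and> (\<forall>i. coord_profile (\<lambda>x. g' x (axis i 1)))"
  using assms
proof (induction rule: coord_profile.induct)
  case (profile G)
  from schwartz_profile_derivative[OF this]
  obtain G' where G': "schwartz_profile G'" "\<And>t. (G has_vector_derivative G' t) (at t)"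
    by auto
  have 1: "((\<lambda>x. G (x \<bullet> x)) has_derivative (\<lambda>v. (x \<bullet> v + v \<bullet> x) *\<^sub>R G' (x \<bullet> x))) (at x)" for x :: "real ^ 'd"
    by (rule has_derivative_compose[OF has_derivative_inner[OF has_derivative_ident has_derivative_ident]
          G'(2)[unfolded has_vector_derivative_def]])
  have 2: "coord_profile (\<lambda>x. (x \<bullet> axis i 1 + axis i 1 \<bullet> x) *\<^sub>R G' (x \<bullet> x))" for i :: 'd
  proof -
    have "(\<lambda>x. (x \<bullet> axis i 1 + axis i 1 \<bullet> x) *\<^sub>R G' (x \<bullet> x)) =
        (\<lambda>x. (x $ i) *\<^sub>R (2 *\<^sub>R G' (x \<bullet> x)))"
      by (simp add: inner_axis inner_axis' mult.commute)
    moreover have "schwartz_profile (\<lambda>t. 2 *\<^sub>R G' t)"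
      by (rule schwartz_profile_bounded_linear[OF bounded_linear_scaleR_right G'(1)])
    ultimately show ?thesis
      using coord_profile.coord[OF coord_profile.profile, of "\<lambda>t. 2 *\<^sub>R G' t" i] by (simp del: scaleR_scaleR)
  qed
  from 1 2 show ?case
    by (intro exI[of _ "\<lambda>x v. (x \<bullet> v + v \<bullet> x) *\<^sub>R G' (x \<bullet> x)"] conjI allI)
next
  case (add g h)
  then obtain g' h' where
    "\<And>x. (g has_derivative g' x) (at x)" "\<And>i. coord_profile (\<lambda>x. g' x (axis i 1))"
    "\<And>x. (h has_derivative h' x) (at x)" "\<And>i. coord_profile (\<lambda>x. h' x (axis i 1))"
    by blast
  then show ?case
    by (intro exI[of _ "\<lambda>x v. g' x v + h' x v"] conjI allI has_derivative_add coord_profile.add)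
next
  case (coord g j)
  then obtain g' where g':
    "\<And>x. (g has_derivative g' x) (at x)" "\<And>i. coord_profile (\<lambda>x. g' x (axis i 1))"
    by blast
  have 1: "((\<lambda>x. (x $ j) *\<^sub>R g x) has_derivative (\<lambda>v. (x $ j) *\<^sub>R g' x v + (v $ j) *\<^sub>R g x)) (at x)" for x
    by (rule has_derivative_scaleR[OF bounded_linear_imp_has_derivative[OF bounded_linear_vec_nth] g'(1)])
  have 2: "coord_profile (\<lambda>x. (x $ j) *\<^sub>R g' x (axis i 1) + (axis i 1 $ j) *\<^sub>R g x)" for i
  proof (rule coord_profile.add[OF coord_profile.coord[OF g'(2)]])
    \<comment> \<open>The coefficient is 1 or 0. In the second case the term is the zero function,
      which belongs to the class through the zero profile.\<close>
    show "coord_profile (\<lambda>x. (axis i 1 $ j) *\<^sub>R g x)"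
      using coord.hyps coord_profile.profile[OF schwartz_profile_0]
      by (cases "i = j") (auto simp: axis_def)
  qed
  from 1 2 show ?case
    by (intro exI[of _ "\<lambda>x v. (x $ j) *\<^sub>R g' x v + (v $ j) *\<^sub>R g x"] conjI allI)
qed

lemma coord_profile_iter_partial: "coord_profile g \<Longrightarrow> coord_profile (iter_partial is g)"
proof (induction "is")
  case (Cons i "is")
  from coord_profile_derivative[OF Cons.IH[OF Cons.prems]] obtain g' where g':
    "\<And>x. (iter_partial is g has_derivative g' x) (at x)" "\<And>i. coord_profile (\<lambda>x. g' x (axis i 1))"
    by blast
  have "frechet_derivative (iter_partial is g) (at x) = g' x" for x
    using frechet_derivative_at[OF g'(1)] by simp
  with g'(2) show ?case by simp
qed simp

lemma schwartz_profile_imp_schwartz: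
  assumes "schwartz_profile G"
  shows "schwartz (\<lambda>x :: real ^ 'd. G (x \<bullet> x))"
proof -
  have *: "coord_profile (iter_partial is (\<lambda>x :: real ^ 'd. G (x \<bullet> x)))" for "is"
    by (intro coord_profile_iter_partial coord_profile.profile assms)
  show ?thesis
    unfolding schwartz_def smooth_function_def
    unfolding differentiable_def
    using coord_profile_decay[OF *] coord_profile_derivative[OF *] by (metis (lifting))
qed

section \<open>Radial profile and radial derivative of functions of
  \<open>x \<bullet> x\<close>\<close>

lemma radial_inner_self: "radial (\<lambda>x :: real ^ 'd. G (x \<bullet> x))"
  unfolding radial_def by (simp add: power2_norm_eq_inner[symmetric])

lemma radial_profile_inner_self:
  assumes "r \<ge> 0"
  shows "radial_profile (\<lambda>x :: real ^ 'd. G (x \<bullet> x)) r = G (r\<^sup>2)"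
proof -
  obtain x :: "real ^ 'd" where "norm x = r"
    using vector_choose_size[OF assms] by blast
  then show ?thesis
    using radial_profile_norm[OF radial_inner_self[of G], of x]
    by (simp add: power2_norm_eq_inner[symmetric])
qed

lemma radial_deriv_inner_self:
  assumes "r > 0" and G': "(G has_vector_derivative G') (at (r\<^sup>2))"
  shows "radial_deriv (\<lambda>x :: real ^ 'd. G (x \<bullet> x)) r = (2 * r) *\<^sub>R G'"
proof -
  have "((\<lambda>r. r\<^sup>2) has_vector_derivative 2 * r) (at r)"
    by (auto intro!: derivative_eq_intros simp flip: has_real_derivative_iff_has_vector_derivative)
  then have "((\<lambda>r. G (r\<^sup>2)) has_vector_derivative (2 * r) *\<^sub>R G') (at r)"
    using vector_diff_chain_at[of "\<lambda>r. r\<^sup>2" "2 * r" r G G'] G' by (simp add: o_def)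
  then have "(radial_profile (\<lambda>x :: real ^ 'd. G (x \<bullet> x)) has_vector_derivative (2 * r) *\<^sub>R G')
      (at r within {0..})"
    by (rule has_vector_derivative_transform[rotated 2, OF has_vector_derivative_at_within])
       (use assms(1) in \<open>auto simp: radial_profile_inner_self\<close>)
  \<comment> \<open>Since \<open>r > 0\<close> is interior to the half-line, the restricted filter
    is the full one; its nontriviality makes the derivative unique.\<close>
  moreover have "at r within {0..} \<noteq> bot"
  proof -
    have "at r within {0..} = at r"
      using assms(1) at_within_interior[of r "{0..}"] by (simp add: interior_real_atLeast)
    then show ?thesis by simp
  qed
  ultimately show ?thesis
    unfolding radial_deriv_def by (intro vector_derivative_within)
qed

subsection \<open>Fourier transforms of complex Gaussians\<close>

text \<open>Lebesgue measure on a Euclidean space is the image of the product of one-dimensional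
  Lebesgue measures under the coordinate map, so Fubini for finite products applies.\<close>

lemma
  fixes g :: "'a::euclidean_space \<Rightarrow> real \<Rightarrow> complex"
  assumes "\<And>b. b \<in> Basis \<Longrightarrow> integrable lborel (g b)"
  shows integrable_lborel_prod: "integrable lborel (\<lambda>x. \<Prod>b\<in>Basis. g b (x \<bullet> b))"
    and integral_lborel_prod:
      "(LINT x|lborel. (\<Prod>b\<in>Basis. g b (x \<bullet> b))) = (\<Prod>b\<in>Basis. LINT u|lborel. g b u)"
proof -
  interpret product_sigma_finite "\<lambda>_ :: 'a. lborel :: real measure" ..
  have [measurable]: "(\<lambda>x. \<Prod>b\<in>Basis. g b (x \<bullet> b)) \<in> borel_measurable borel"
  proof (rule borel_measurable_prod)
    fix b :: 'a assume "b \<in> Basis"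
    from borel_measurable_integrable[OF assms[OF this]]
    have [measurable]: "g b \<in> borel_measurable borel" by simp
    show "(\<lambda>x. g b (x \<bullet> b)) \<in> borel_measurable borel" by measurable
  qed
  have eq: "(\<Prod>b\<in>Basis. g b ((\<Sum>i\<in>Basis. f i *\<^sub>R i) \<bullet> b)) = (\<Prod>b\<in>Basis. g b (f b))" for f
    by (intro prod.cong) auto
  show "integrable lborel (\<lambda>x. \<Prod>b\<in>Basis. g b (x \<bullet> b))"
    by (subst lborel_eq) (simp add: integrable_distr_eq eq product_integrable_prod assms)
  show "(LINT x|lborel. (\<Prod>b\<in>Basis. g b (x \<bullet> b))) = (\<Prod>b\<in>Basis. LINT u|lborel. g b u)"
    by (subst lborel_eq) (simp add: integral_distr eq product_integral_prod assms)
qed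

text \<open>A rescaling of the characteristic function \<open>exp (- t^2 / 2)\<close> of the
  standard normal distribution.\<close>

lemma gaussian_fourier_real:
  fixes b v :: real
  assumes "b > 0"
  shows "has_bochner_integral lborel
    (\<lambda>u. exp (- of_real b * (of_real u)\<^sup>2 - 2 * of_real pi * \<i> * of_real (u * v)))
    (of_real (sqrt (pi / b) * exp (- (pi\<^sup>2 * v\<^sup>2 / b))))"
proof -
  \<comment> \<open>With \<open>x = c u\<close> the density exponent \<open>- x^2 / 2\<close>
    becomes \<open>- b u^2\<close>; \<open>t\<close> is then chosen so that the phase
    \<open>t x\<close> becomes \<open>- 2 pi u v\<close>.\<close>
  define c where "c = sqrt (2 * b)"
  define t where "t = - (2 * pi * v / c)"
  have c: "c > 0" "c\<^sup>2 = 2 * b" using assms by (auto simp: c_def)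
  define \<phi> where "\<phi> = (\<lambda>x. std_normal_density x *\<^sub>R iexp (t * x))"
  interpret prob_space std_normal_distribution
    by (rule real_distribution.axioms(1)) (rule real_dist_normal_dist)
  have meas: "(\<lambda>x. iexp (t * x)) \<in> borel_measurable borel"
    by measurable
  have "integrable std_normal_distribution (\<lambda>x. iexp (t * x))"
    by (rule integrable_const_bound[where B = 1]) (use meas in auto)
  then have int: "integrable lborel \<phi>"
    unfolding \<phi>_def by (subst (asm) integrable_density) (use meas in auto)
  have "(LINT x|lborel. \<phi> x) = (LINT x|std_normal_distribution. iexp (t * x))"
    unfolding \<phi>_def by (subst integral_density) (use meas in auto)
  also have "\<dots> = of_real (exp (- (t\<^sup>2) / 2))"
    using fun_cong[OF char_std_normal_distribution, of t] by (simp add: char_def)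
  also have "t\<^sup>2 / 2 = pi\<^sup>2 * v\<^sup>2 / b"
    using c assms by (simp add: t_def power_mult_distrib power_divide)
  then have "- (t\<^sup>2) / 2 = - (pi\<^sup>2 * v\<^sup>2 / b)" by simp
  finally have val: "(LINT x|lborel. \<phi> x) = of_real (exp (- (pi\<^sup>2 * v\<^sup>2 / b)))" .
  have "has_bochner_integral lborel \<phi> (of_real (exp (- (pi\<^sup>2 * v\<^sup>2 / b))))"
    using int val by (simp add: has_bochner_integral_iff)
  then have "has_bochner_integral lborel (\<lambda>x. \<phi> (0 + c * x)) (of_real (exp (- (pi\<^sup>2 * v\<^sup>2 / b))) /\<^sub>R \<bar>c\<bar>)"
    using c by (intro lborel_has_bochner_integral_real_affine_iff[THEN iffD1]) auto
  then have "has_bochner_integral lborel (\<lambda>x. complex_of_real (sqrt (2 * pi)) * \<phi> (0 + c * x))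
      (complex_of_real (sqrt (2 * pi)) * (of_real (exp (- (pi\<^sup>2 * v\<^sup>2 / b))) /\<^sub>R \<bar>c\<bar>))"
    by (intro has_bochner_integral_mult_right)
  moreover have "complex_of_real (sqrt (2 * pi)) * \<phi> (0 + c * x) =
      exp (- of_real b * (of_real x)\<^sup>2 - 2 * of_real pi * \<i> * of_real (x * v))" for x
  proof -
    have "complex_of_real (sqrt (2 * pi)) * \<phi> (0 + c * x) =
        of_real (sqrt (2 * pi) * std_normal_density (c * x)) * iexp (t * (c * x))"
      by (simp add: \<phi>_def scaleR_conv_of_real)
    also have "sqrt (2 * pi) * std_normal_density (c * x) = exp (- b * x\<^sup>2)"
      using c by (simp add: std_normal_density_def power_mult_distrib)
    also have "t * (c * x) = - 2 * pi * v * x"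
      using c by (simp add: t_def)
    finally show ?thesis
      by (simp add: exp_of_real[symmetric] exp_add[symmetric] mult_ac)
  qed
  moreover have "complex_of_real (sqrt (2 * pi)) * (of_real (exp (- (pi\<^sup>2 * v\<^sup>2 / b))) /\<^sub>R \<bar>c\<bar>) =
     of_real (sqrt (pi / b) * exp (- (pi\<^sup>2 * v\<^sup>2 / b)))"
  proof -
    have "sqrt (2 * pi) / c = sqrt (pi / b)"
      unfolding c_def by (simp add: real_sqrt_divide[symmetric])
    then show ?thesis
      using c by (simp add: scaleR_conv_of_real field_simps flip: of_real_mult of_real_divide)
  qed
  ultimately show ?thesis by simp
qed

text \<open>Both exponents are sums over coordinates, so the integrand is a product of
  one-dimensional Gaussians with phases.\<close>

lemma
  fixes y :: "'a::euclidean_space" and b :: real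
  assumes "b > 0"
  shows integrable_gaussian_fourier_of_real:
      "integrable lborel (\<lambda>x. exp (- of_real b * of_real (x \<bullet> x) - 2 * of_real pi * \<i> * of_real (x \<bullet> y)))"
    and integral_gaussian_fourier_of_real:
      "(LINT x|lborel. exp (- of_real b * of_real (x \<bullet> x) - 2 * of_real pi * \<i> * of_real (x \<bullet> y))) =
       of_real (sqrt (pi / b) ^ DIM('a) * exp (- (pi\<^sup>2 * (y \<bullet> y) / b)))"
proof -
  define g where "g = (\<lambda>e u. exp (- complex_of_real b * (of_real u)\<^sup>2 - 2 * of_real pi * \<i> * of_real (u * (y \<bullet> e))))"
  have bi: "has_bochner_integral lborel (g e) (of_real (sqrt (pi / b) * exp (- (pi\<^sup>2 * (y \<bullet> e)\<^sup>2 / b))))" for e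
    unfolding g_def by (rule gaussian_fourier_real[OF assms])
  have prod: "(\<lambda>x :: 'a. \<Prod>e\<in>Basis. g e (x \<bullet> e)) =
      (\<lambda>x. exp (- of_real b * of_real (x \<bullet> x) - 2 * of_real pi * \<i> * of_real (x \<bullet> y)))"
  proof
    fix x :: 'a
    have "(\<Prod>e\<in>Basis. g e (x \<bullet> e)) =
      exp (\<Sum>e\<in>Basis. - complex_of_real b * (of_real (x \<bullet> e))\<^sup>2 - 2 * of_real pi * \<i> * of_real ((x \<bullet> e) * (y \<bullet> e)))"
      unfolding g_def by (simp add: exp_sum)
    also have "(\<Sum>e\<in>Basis. - complex_of_real b * (of_real (x \<bullet> e))\<^sup>2 - 2 * of_real pi * \<i> * of_real ((x \<bullet> e) * (y \<bullet> e)))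
       = - of_real b * of_real (x \<bullet> x) - 2 * of_real pi * \<i> * of_real (x \<bullet> y)"
      unfolding euclidean_inner[of x x] euclidean_inner[of x y]
      by (simp add: sum_subtractf sum_distrib_left power2_eq_square sum_negf)
    finally show "(\<Prod>e\<in>Basis. g e (x \<bullet> e)) =
      exp (- of_real b * of_real (x \<bullet> x) - 2 * of_real pi * \<i> * of_real (x \<bullet> y))" .
  qed
  have int: "integrable lborel (g e)" for e
    using bi by (simp add: has_bochner_integral_iff)
  show "integrable lborel (\<lambda>x. exp (- of_real b * of_real (x \<bullet> x) - 2 * of_real pi * \<i> * of_real (x \<bullet> y)))"
    using integrable_lborel_prod[of g] int unfolding prod by simp
  have "(LINT x|lborel. exp (- of_real b * of_real (x \<bullet> x) - 2 * of_real pi * \<i> * of_real (x \<bullet> y))) =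
      (\<Prod>e\<in>(Basis :: 'a set). LINT u|lborel. g e u)"
    using integral_lborel_prod[of g] int unfolding prod by simp
  also have "\<dots> = (\<Prod>e\<in>(Basis :: 'a set). of_real (sqrt (pi / b) * exp (- (pi\<^sup>2 * (y \<bullet> e)\<^sup>2 / b))))"
    using bi by (simp add: has_bochner_integral_iff)
  also have "\<dots> = of_real (sqrt (pi / b) ^ DIM('a) * (\<Prod>e\<in>(Basis :: 'a set). exp (- (pi\<^sup>2 * (y \<bullet> e)\<^sup>2 / b))))"
    by (simp add: prod.distrib)
  also have "(\<Prod>e\<in>(Basis :: 'a set). exp (- (pi\<^sup>2 * (y \<bullet> e)\<^sup>2 / b))) = exp (- (pi\<^sup>2 * (y \<bullet> y) / b))"
    by (subst euclidean_inner[of y y])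
       (simp add: exp_sum[symmetric] sum_negf sum_divide_distrib sum_distrib_left power2_eq_square)
  finally show "(LINT x|lborel. exp (- of_real b * of_real (x \<bullet> x) - 2 * of_real pi * \<i> * of_real (x \<bullet> y))) =
       of_real (sqrt (pi / b) ^ DIM('a) * exp (- (pi\<^sup>2 * (y \<bullet> y) / b)))" .
qed

section \<open>Passage from real to complex rates\<close>

lemma integrable_gaussian:
  assumes "b > 0"
  shows "integrable lborel (\<lambda>x :: 'a::euclidean_space. exp (- b * (x \<bullet> x)))"
  using integrable_norm[OF integrable_gaussian_fourier_of_real[OF assms, of "0 :: 'a"]] by simp

lemma integrable_gaussian_fourier:
  fixes y :: "'a::euclidean_space"
  assumes "Re b > 0"
  shows "integrable lborel (\<lambda>x. exp (- b * of_real (x \<bullet> x) - 2 * of_real pi * \<i> * of_real (x \<bullet> y)))"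
  by (rule Bochner_Integration.integrable_bound[OF integrable_gaussian[OF assms]]) auto

text \<open>Differentiation under the integral sign: along any sequence tending to \<open>b\<close>
  the difference quotients converge pointwise and are dominated by one Gaussian.\<close>

lemma gaussian_fourier_holomorphic:
  fixes y :: "'a::euclidean_space"
  shows "(\<lambda>b. LINT x|lborel. exp (- b * of_real (x \<bullet> x) - 2 * of_real pi * \<i> * of_real (x \<bullet> y)))
    holomorphic_on {b. Re b > 0}"
proof -
  define k where "k = (\<lambda>b (x :: 'a). exp (- b * of_real (x \<bullet> x) - 2 * of_real pi * \<i> * of_real (x \<bullet> y)))"
  have intk: "integrable lborel (k b)" if "Re b > 0" for b
    unfolding k_def by (rule integrable_gaussian_fourier[OF that])
  have "((\<lambda>b. LINT x|lborel. k b x) has_field_derivative (LINT x|lborel. - of_real (x \<bullet> x) * k b x)) (at b)"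
    if b: "Re b > 0" for b
    unfolding has_field_derivative_iff
  proof (rule tendsto_at_iff_sequentially[THEN iffD2], intro allI impI)
    fix Z :: "nat \<Rightarrow> complex" assume Z: "\<forall>i. Z i \<in> UNIV - {b}" "Z \<longlonglongrightarrow> b"
    \<comment> \<open>The sequence eventually stays in the half-plane \<open>Re z > c\<close>, on
      which the decay of the kernel is uniform; \<open>b\<close> lies in it as well.\<close>
    define c where "c = Re b / 2"
    have c: "c > 0" using b by (simp add: c_def)
    have kd: "((\<lambda>b. k b x) has_field_derivative - of_real (x \<bullet> x) * k z x) (at z within S)" for z x S
      unfolding k_def by (auto intro!: derivative_eq_intros)
    have "\<forall>\<^sub>F n in sequentially. Re (Z n) > c"
      using order_tendstoD(1)[OF tendsto_Re[OF Z(2)], of c] b by (simp add: c_def)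
    then obtain N where N: "\<And>n. n \<ge> N \<Longrightarrow> Re (Z n) > c"
      by (auto simp: eventually_sequentially)
    have bound: "norm ((k z x - k b x) / (z - b)) \<le> 2 / c * exp (- (c / 2) * (x \<bullet> x))"
      if z: "Re z > c" "z \<noteq> b" for x z
    proof -
      \<comment> \<open>Mean value inequality on the convex half-plane: a bound for the derivative
        in the rate bounds the difference quotient.\<close>
      have "norm (k z x - k b x) \<le> (2 / c * exp (- (c / 2) * (x \<bullet> x))) * norm (z - b)"
      proof (rule field_differentiable_bound[where S = "{z. Re z > c}"])
        show "convex {z. Re z > c}" by (rule convex_halfspace_Re_gt)
        show "norm (- of_real (x \<bullet> x) * k w x) \<le> 2 / c * exp (- (c / 2) * (x \<bullet> x))"
          if "w \<in> {z. Re z > c}" for w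
        proof -
          have "norm (- of_real (x \<bullet> x) * k w x) = (x \<bullet> x) * exp (- Re w * (x \<bullet> x))"
            by (simp add: k_def norm_mult)
          also have "\<dots> \<le> (x \<bullet> x) * exp (- c * (x \<bullet> x))"
            using that by (intro mult_left_mono) (auto intro: mult_right_mono)
          \<comment> \<open>Half of the exponential decay is spent on absorbing
            \<open>x \<bullet> x\<close>, by \<open>u \<le> exp u\<close> with
            \<open>u = c / 2 * (x \<bullet> x)\<close>.\<close>
          also have "\<dots> \<le> (2 / c * exp (c / 2 * (x \<bullet> x))) * exp (- c * (x \<bullet> x))"
          proof (rule mult_right_mono)
            have "c / 2 * (x \<bullet> x) \<le> exp (c / 2 * (x \<bullet> x))"
              using exp_ge_add_one_self[of "c / 2 * (x \<bullet> x)"] by linarith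
            then show "x \<bullet> x \<le> 2 / c * exp (c / 2 * (x \<bullet> x))"
              using c by (simp add: field_simps)
          qed simp
          also have "\<dots> = 2 / c * exp (- (c / 2) * (x \<bullet> x))"
            by (simp add: exp_add[symmetric] mult.assoc)
          finally show ?thesis .
        qed
      qed (use z c_def c kd in auto)
      then show ?thesis
        using z by (simp add: norm_divide pos_divide_le_eq)
    qed
    \<comment> \<open>The shift by \<open>N\<close> discards the initial terms that may lie outside
      the half-plane where the bound holds.\<close>
    have "(\<lambda>n. LINT x|lborel. (k (Z (n + N)) x - k b x) / (Z (n + N) - b)) \<longlonglongrightarrow>
        (LINT x|lborel. - of_real (x \<bullet> x) * k b x)"
    proof (rule integral_dominated_convergence)
      show "integrable lborel (\<lambda>x :: 'a. 2 / c * exp (- (c / 2) * (x \<bullet> x)))"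
        using c by (intro integrable_mult_right integrable_gaussian) auto
      show "AE x in lborel. (\<lambda>n. (k (Z (n + N)) x - k b x) / (Z (n + N) - b)) \<longlonglongrightarrow> - of_real (x \<bullet> x) * k b x"
      proof (rule AE_I2)
        fix x :: 'a
        from kd[of x b UNIV] have "((\<lambda>z. (k z x - k b x) / (z - b)) \<longlongrightarrow> - of_real (x \<bullet> x) * k b x) (at b)"
          by (simp add: has_field_derivative_iff)
        with Z have "(\<lambda>n. (k (Z n) x - k b x) / (Z n - b)) \<longlonglongrightarrow> - of_real (x \<bullet> x) * k b x"
          unfolding tendsto_at_iff_sequentially o_def by blast
        then show "(\<lambda>n. (k (Z (n + N)) x - k b x) / (Z (n + N) - b)) \<longlonglongrightarrow> - of_real (x \<bullet> x) * k b x"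
          by (rule LIMSEQ_ignore_initial_segment)
      qed
      show "AE x in lborel. norm ((k (Z (n + N)) x - k b x) / (Z (n + N) - b)) \<le> 2 / c * exp (- (c / 2) * (x \<bullet> x))" for n
        using Z(1) N[of "n + N"] by (intro AE_I2 bound) auto
    qed (simp_all add: k_def)
    moreover have "(LINT x|lborel. (k (Z (n + N)) x - k b x) / (Z (n + N) - b)) =
        ((LINT x|lborel. k (Z (n + N)) x) - (LINT x|lborel. k b x)) / (Z (n + N) - b)" for n
    proof -
      have "Re (Z (n + N)) > 0" using N[of "n + N"] c by simp
      from intk[OF this] intk[OF b] show ?thesis
        by (simp only: integral_divide_zero Bochner_Integration.integral_diff)
    qed
    ultimately have "(\<lambda>n. ((LINT x|lborel. k (Z (n + N)) x) - (LINT x|lborel. k b x)) / (Z (n + N) - b))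
        \<longlonglongrightarrow> (LINT x|lborel. - of_real (x \<bullet> x) * k b x)"
      by (simp only:)
    then show "((\<lambda>z. ((LINT x|lborel. k z x) - (LINT x|lborel. k b x)) / (z - b)) \<circ> Z)
        \<longlonglongrightarrow> (LINT x|lborel. - of_real (x \<bullet> x) * k b x)"
      unfolding o_def by (rule LIMSEQ_offset)
  qed
  then have "(\<lambda>b. LINT x|lborel. k b x) holomorphic_on {b. Re b > 0}"
    unfolding holomorphic_on_open[OF open_halfspace_Re_gt] by blast
  then show ?thesis
    unfolding k_def .
qed

text \<open>Identity theorem: both sides are holomorphic on the right half-plane and agree on the
  positive reals, which accumulate at 1. Even dimension makes \<open>(pi / b)^(d/2)\<close> an
  integer power, so no branch of the square root has to be chosen.\<close>

lemma integral_gaussian_fourier: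
  fixes y :: "'a::euclidean_space"
  assumes "even DIM('a)" and "Re b > 0"
  shows "(LINT x|lborel. exp (- b * of_real (x \<bullet> x) - 2 * of_real pi * \<i> * of_real (x \<bullet> y))) =
    (of_real pi / b) ^ (DIM('a) div 2) * exp (- (of_real (pi\<^sup>2 * (y \<bullet> y)) / b))"
proof -
  define L where "L = (\<lambda>b. LINT x|lborel. exp (- b * of_real (x \<bullet> x) - 2 * of_real pi * \<i> * of_real (x \<bullet> y)))"
  define R :: "complex \<Rightarrow> complex" where "R = (\<lambda>b. (of_real pi / b) ^ (DIM('a) div 2) * exp (- (of_real (pi\<^sup>2 * (y \<bullet> y)) / b)))"
  have "L b - R b = 0"
  proof (rule analytic_continuation[where f = "\<lambda>b. L b - R b" and w = b and S = "{b. Re b > 0}" and U = "of_real ` {0<..}" and \<xi> = 1])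
    show "(\<lambda>b. L b - R b) holomorphic_on {b. Re b > 0}"
      unfolding L_def R_def
      by (intro holomorphic_intros gaussian_fourier_holomorphic) auto
    show "open {b. Re b > 0}" by (rule open_halfspace_Re_gt)
    show "connected {b. Re b > 0}" by (intro convex_connected convex_halfspace_Re_gt)
    have "(1 :: real) islimpt {0<..}"
      by (intro interior_limit_point) (simp add: interior_open)
    then have "(\<exists>X. (\<forall>n. X n \<in> {0<..} - {1 :: real}) \<and> X \<longlonglongrightarrow> 1)"
      by (simp add: islimpt_sequential)
    then obtain X where X: "\<And>n. X n \<in> {0<..} - {1 :: real}" "X \<longlonglongrightarrow> 1" by blast
    show "(1 :: complex) islimpt of_real ` {0<..}"
      unfolding islimpt_sequential
      using X tendsto_of_real[OF X(2), where 'a = complex] by (intro exI[of _ "\<lambda>n. of_real (X n)"]) auto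
    show "L z - R z = 0" if "z \<in> of_real ` {0<..}" for z
    proof -
      from that obtain r where r: "r > 0" "z = of_real r" by auto
      have "L z = of_real (sqrt (pi / r) ^ DIM('a) * exp (- (pi\<^sup>2 * (y \<bullet> y) / r)))"
        unfolding L_def r(2) by (rule integral_gaussian_fourier_of_real[OF r(1)])
      also have "sqrt (pi / r) ^ DIM('a) = (pi / r) ^ (DIM('a) div 2)"
        using r(1) assms(1) by (auto elim!: evenE simp: power_mult)
      also have "of_real (\<dots> * exp (- (pi\<^sup>2 * (y \<bullet> y) / r))) = R z"
        by (simp add: R_def r exp_of_real[symmetric])
      finally show ?thesis by simp
    qed
  qed (use assms in auto)
  then show ?thesis by (simp add: L_def R_def)
qed

subsection \<open>Superpositions of Gaussians\<close>

text \<open>At \<open>t = |x|^2\<close> this is a superposition of Gaussians with rates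
  \<open>a s\<close> and weights \<open>h s\<close>. Keeping both as parameters makes the family
  closed under the operations needed: a derivative in \<open>t\<close> only changes the weight, and
  the Fourier transform changes weight and rate.\<close>

definition exp_mixture :: "real \<Rightarrow> real \<Rightarrow> (real \<Rightarrow> complex) \<Rightarrow> (real \<Rightarrow> complex) \<Rightarrow> real \<Rightarrow> complex" where
  "exp_mixture p q h a t = integral {p..q} (\<lambda>s. h s * exp (- a s * of_real t))"

lemma exp_mixture_has_vector_derivative:
  assumes "continuous_on {p..q} h" "continuous_on {p..q} a"
  shows "(exp_mixture p q h a has_vector_derivative exp_mixture p q (\<lambda>s. - a s * h s) a t) (at t)"
proof -
  have cont: "continuous_on ((UNIV :: real set) \<times> {p..q}) (\<lambda>(t, s). - a s * h s * exp (- a s * of_real t))"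
    unfolding split_beta
    by (intro continuous_intros continuous_on_compose2[OF assms(1)] continuous_on_compose2[OF assms(2)]) auto
  have "((\<lambda>t. integral (cbox p q) (\<lambda>s. h s * exp (- a s * of_real t))) has_vector_derivative
      integral (cbox p q) (\<lambda>s. - a s * h s * exp (- a s * of_real t))) (at t within UNIV)"
  proof (rule leibniz_rule_vector_derivative)
    show "((\<lambda>t. h s * exp (- a s * of_real t)) has_vector_derivative - a s * h s * exp (- a s * of_real t))
        (at t within UNIV)" for t s
      by (rule has_vector_derivative_real_field) (auto intro!: derivative_eq_intros)
    show "(\<lambda>s. h s * exp (- a s * of_real t)) integrable_on cbox p q" for t
      by (intro integrable_continuous) (auto intro!: continuous_intros assms)
    show "continuous_on (UNIV \<times> cbox p q) (\<lambda>(t, s). - a s * h s * exp (- a s * of_real t))"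
      using cont by simp
  qed auto
  then show ?thesis
    unfolding exp_mixture_def[abs_def] by simp
qed

text \<open>Compactness yields a uniform decay rate; for \<open>p > q\<close> there is nothing to
  bound and any positive \<open>c\<close> works.\<close>

lemma Re_lower_bound:
  fixes a :: "real \<Rightarrow> complex"
  assumes "continuous_on {p..q} a" "\<And>s. s \<in> {p..q} \<Longrightarrow> Re (a s) > 0"
  obtains c where "c > 0" "\<And>s. s \<in> {p..q} \<Longrightarrow> Re (a s) \<ge> c"
proof (cases "p \<le> q")
  case True
  have "continuous_on {p..q} (\<lambda>s. Re (a s))"
    by (intro continuous_intros assms)
  moreover have "{p..q} \<noteq> {}" using True by simp
  ultimately obtain s0 where
    "s0 \<in> {p..q}" "\<And>s. s \<in> {p..q} \<Longrightarrow> Re (a s0) \<le> Re (a s)"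
    using continuous_attains_inf[OF compact_Icc] by blast
  with assms(2)[of s0] show ?thesis by (intro that[of "Re (a s0)"]) auto
qed (auto intro: that[of 1])

text \<open>The integrand is at most \<open>M exp (- c t)\<close> for \<open>t \<ge> 0\<close>, with
  \<open>M\<close> bounding the weight and \<open>c\<close> the rates, and an exponential beats
  every power.\<close>

lemma exp_mixture_decay:
  assumes "p \<le> q" "continuous_on {p..q} h" "continuous_on {p..q} a"
    and "\<And>s. s \<in> {p..q} \<Longrightarrow> Re (a s) > 0"
  shows "((\<lambda>t. t ^ m *\<^sub>R exp_mixture p q h a t) \<longlongrightarrow> 0) at_top"
proof -
  obtain c where c: "c > 0" "\<And>s. s \<in> {p..q} \<Longrightarrow> Re (a s) \<ge> c"
    using Re_lower_bound[OF assms(3,4)] by metis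
  have "bounded (h ` {p..q})"
    by (rule compact_imp_bounded[OF compact_continuous_image[OF assms(2) compact_Icc]])
  then obtain M where "\<forall>z \<in> h ` {p..q}. norm z \<le> M"
    unfolding bounded_iff ..
  then have M: "norm (h s) \<le> M" if "s \<in> {p..q}" for s
    using that by blast
  have "M \<ge> 0" using M[of p] assms(1) norm_ge_zero[of "h p"] by (meson atLeastAtMost_iff order_refl order_trans)
  have bound: "norm (exp_mixture p q h a t) \<le> M * exp (- c * t) * (q - p)" if "t \<ge> 0" for t
    unfolding exp_mixture_def
  proof (rule integral_bound[OF assms(1)])
    show "continuous_on {p..q} (\<lambda>s. h s * exp (- a s * of_real t))"
      by (intro continuous_intros assms)
    show "norm (h s * exp (- a s * of_real t)) \<le> M * exp (- c * t)" if s: "s \<in> {p..q}" for s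
    proof -
      have "norm (exp (- a s * of_real t)) \<le> exp (- c * t)"
        using c(2)[OF s] \<open>t \<ge> 0\<close> by (simp add: mult_right_mono)
      with M[OF s] \<open>M \<ge> 0\<close> show ?thesis
        unfolding norm_mult by (intro mult_mono) auto
    qed
  qed
  \<comment> \<open>The limit of \<open>u^m / exp u\<close> is used at \<open>u = c t\<close>; the
    surplus factor \<open>c^m\<close> is cancelled in the constant \<open>K\<close> below.\<close>
  have "filterlim (\<lambda>t. c * t) at_top at_top"
    by (intro filterlim_tendsto_pos_mult_at_top[OF tendsto_const c(1)] filterlim_ident)
  from filterlim_compose[OF tendsto_power_div_exp_0[of m] this]
  have "((\<lambda>t. (c * t) ^ m / exp (c * t)) \<longlongrightarrow> 0) at_top" .
  then show ?thesis
  proof (rule tendsto_0_le[where K = "M * (q - p) / c ^ m"])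
    show "\<forall>\<^sub>F t in at_top. norm (t ^ m *\<^sub>R exp_mixture p q h a t)
        \<le> norm ((c * t) ^ m / exp (c * t)) * (M * (q - p) / c ^ m)"
      using eventually_ge_at_top[of 0]
    proof eventually_elim
      case (elim t)
      have "norm (t ^ m *\<^sub>R exp_mixture p q h a t) \<le> t ^ m * (M * exp (- c * t) * (q - p))"
        using elim bound[OF elim] by (simp add: mult_left_mono)
      also have "\<dots> = norm ((c * t) ^ m / exp (c * t)) * (M * (q - p) / c ^ m)"
        using elim c(1) by (simp add: power_mult_distrib exp_minus field_simps)
      finally show ?case .
    qed
  qed
qed

text \<open>Each derivative in \<open>t\<close> multiplies the weight by \<open>- a s\<close>, so
  every derivative is a mixture with the same rates and decays for the same reason.\<close>

lemma schwartz_profile_exp_mixture: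
  assumes "p \<le> q" "continuous_on {p..q} h" "continuous_on {p..q} a"
    and "\<And>s. s \<in> {p..q} \<Longrightarrow> Re (a s) > 0"
  shows "schwartz_profile (exp_mixture p q h a)"
proof -
  define D where "D = (\<lambda>k. exp_mixture p q (\<lambda>s. (- a s) ^ k * h s) a)"
  have cont: "continuous_on {p..q} (\<lambda>s. (- a s) ^ k * h s)" for k
    by (intro continuous_intros assms)
  have "D 0 = exp_mixture p q h a" by (simp add: D_def)
  moreover have "(D k has_vector_derivative D (Suc k) t) (at t)" for k t
    using exp_mixture_has_vector_derivative[OF cont[of k] assms(3), of t]
    by (simp add: D_def mult.assoc)
  moreover have "((\<lambda>t. t ^ m *\<^sub>R D k t) \<longlongrightarrow> 0) at_top" for k m
    unfolding D_def by (rule exp_mixture_decay[OF assms(1) cont assms(3,4)])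
  ultimately show ?thesis
    unfolding schwartz_profile_def by blast
qed

text \<open>Fubini moves the space integral inside, where each Gaussian of rate \<open>a s\<close>
  transforms into one of rate \<open>pi^2 / a s\<close> with the factor
  \<open>(pi / a s)^(d/2)\<close>. Continuity of \<open>h\<close> and \<open>a\<close> on the whole
  line supplies measurability of the joint kernel.\<close>

lemma
  fixes h a :: "real \<Rightarrow> complex" and y :: "real ^ 'd"
  assumes "p \<le> q" and h: "continuous_on UNIV h" and a: "continuous_on UNIV a"
    and pos: "\<And>s. s \<in> {p..q} \<Longrightarrow> Re (a s) > 0" and "even CARD('d)"
  shows integrable_exp_mixture: "integrable lborel (\<lambda>x :: real ^ 'd. exp_mixture p q h a (x \<bullet> x))"
    and fourier_transform_exp_mixture: "fourier_transform (\<lambda>x. exp_mixture p q h a (x \<bullet> x)) y =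
      exp_mixture p q (\<lambda>s. h s * (of_real pi / a s) ^ (CARD('d) div 2)) (\<lambda>s. of_real (pi\<^sup>2) / a s) (y \<bullet> y)"
proof -
  \<comment> \<open>The indicator turns the integral over \<open>{p..q}\<close> into one over the
    line, so that Fubini applies to a product of two Lebesgue measures.\<close>
  define K where "K = (\<lambda>y (x :: real ^ 'd) s. indicat_real {p..q} s *\<^sub>R
      (h s * exp (- a s * of_real (x \<bullet> x) - 2 * of_real pi * \<i> * of_real (x \<bullet> y))))"
  have h': "continuous_on {p..q} h" and a': "continuous_on {p..q} a"
    using h a continuous_on_subset by blast+
  obtain c where c: "c > 0" "\<And>s. s \<in> {p..q} \<Longrightarrow> Re (a s) \<ge> c"
    using Re_lower_bound[OF a' pos] by metis
  have "bounded (h ` {p..q})"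
    by (rule compact_imp_bounded[OF compact_continuous_image[OF h' compact_Icc]])
  then obtain M where "\<forall>z \<in> h ` {p..q}. norm z \<le> M"
    unfolding bounded_iff ..
  then have M: "norm (h s) \<le> M" if "s \<in> {p..q}" for s
    using that by blast
  have [measurable]: "h \<in> borel_measurable borel" "a \<in> borel_measurable borel"
    using h a by (auto intro: borel_measurable_continuous_onI)
  have ind: "(LINT s|lborel. norm (indicat_real {p..q} s *\<^sub>R w)) = (q - p) * norm w" for w :: real
  proof -
    have "(LINT s|lborel. norm (indicat_real {p..q} s *\<^sub>R w)) = (LINT s|lborel. indicat_real {p..q} s * norm w)"
      by (intro Bochner_Integration.integral_cong) (auto split: split_indicator)
    then show ?thesis using \<open>p \<le> q\<close> by simp
  qed
  \<comment> \<open>A dominating function for the kernel, the same for every \<open>y\<close>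
    because the phase has modulus 1.\<close>
  have bound_int: "integrable (lborel \<Otimes>\<^sub>M lborel)
      (\<lambda>(x :: real ^ 'd, s). indicat_real {p..q} s *\<^sub>R (M * exp (- c * (x \<bullet> x))))"
  proof (rule lborel_pair.Fubini_integrable)
    have "integrable lborel (\<lambda>x :: real ^ 'd. (q - p) * norm (M * exp (- c * (x \<bullet> x))))"
      by (intro integrable_mult_right integrable_norm integrable_gaussian c)
    then show "integrable lborel (\<lambda>x :: real ^ 'd. LINT s|lborel.
        norm (case (x, s) of (x, s) \<Rightarrow> indicat_real {p..q} s *\<^sub>R (M * exp (- c * (x \<bullet> x)))))"
      by (simp only: ind prod.case)
  qed (use \<open>p \<le> q\<close> in \<open>simp_all add: split_beta integrable_real_indicator\<close>)
  have K_int: "integrable (lborel \<Otimes>\<^sub>M lborel) (\<lambda>(x, s). K y x s)" for y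
  proof (rule Bochner_Integration.integrable_bound[OF bound_int])
    show "(\<lambda>(x, s). K y x s) \<in> borel_measurable (lborel \<Otimes>\<^sub>M lborel)"
      unfolding K_def split_beta by measurable
    have "norm (K y x s) \<le> norm (indicat_real {p..q} s *\<^sub>R (M * exp (- c * (x \<bullet> x))))" for x s
    proof (cases "s \<in> {p..q}")
      case True
      have "norm (K y x s) = norm (h s) * exp (- Re (a s) * (x \<bullet> x))"
        using True by (simp add: K_def norm_mult)
      also have "\<dots> \<le> M * exp (- c * (x \<bullet> x))"
        using M[OF True] c(2)[OF True] by (intro mult_mono) (auto intro: mult_right_mono order_trans[OF norm_ge_zero])
      finally show ?thesis using True by simp
    qed (simp add: K_def)
    then show "AE z in lborel \<Otimes>\<^sub>M lborel. norm (case z of (x, s) \<Rightarrow> K y x s)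
      \<le> norm (case z of (x, s) \<Rightarrow> indicat_real {p..q} s *\<^sub>R (M * exp (- c * (x \<bullet> x))))"
      by (intro AE_I2) (auto split: prod.split)
  qed
  have inner: "(LINT s|lborel. K y x s) =
      exp_mixture p q h a (x \<bullet> x) * exp (- 2 * of_real pi * \<i> * of_real (x \<bullet> y))" for x y
  proof -
    have "continuous_on {p..q} (\<lambda>s. h s * exp (- a s * of_real (x \<bullet> x) - 2 * of_real pi * \<i> * of_real (x \<bullet> y)))"
      by (intro continuous_intros h' a')
    from set_borel_integral_eq_integral(2)[OF borel_integrable_atLeastAtMost'[OF this]]
    have "(LINT s|lborel. K y x s) =
        integral {p..q} (\<lambda>s. h s * exp (- a s * of_real (x \<bullet> x) - 2 * of_real pi * \<i> * of_real (x \<bullet> y)))"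
      by (simp add: K_def set_lebesgue_integral_def)
    also have "\<dots> = integral {p..q} (\<lambda>s. (h s * exp (- a s * of_real (x \<bullet> x))) * exp (- 2 * of_real pi * \<i> * of_real (x \<bullet> y)))"
      by (simp add: exp_diff exp_minus field_simps)
    finally show ?thesis
      unfolding exp_mixture_def by simp
  qed
  show "integrable lborel (\<lambda>x :: real ^ 'd. exp_mixture p q h a (x \<bullet> x))"
    \<comment> \<open>At \<open>y = 0\<close> the phase is 1, and the inner integral is the mixture
      itself.\<close>
    using lborel_pair.integrable_fst[OF K_int[of 0]] by (simp add: inner)
  have "fourier_transform (\<lambda>x. exp_mixture p q h a (x \<bullet> x)) y = (LINT x|lborel. LINT s|lborel. K y x s)"
    unfolding fourier_transform_def by (simp only: inner)
  also have "\<dots> = (LINT s|lborel. LINT x|lborel. K y x s)"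
    by (rule lborel_pair.Fubini_integral[OF K_int, symmetric])
  also have "\<dots> = (LINT s|lborel. indicat_real {p..q} s *\<^sub>R (h s * (of_real pi / a s) ^ (CARD('d) div 2) *
      exp (- (of_real (pi\<^sup>2) / a s) * of_real (y \<bullet> y))))"
  proof (intro Bochner_Integration.integral_cong refl)
    fix s
    show "(LINT x|lborel. K y x s) = indicat_real {p..q} s *\<^sub>R (h s * (of_real pi / a s) ^ (CARD('d) div 2) *
      exp (- (of_real (pi\<^sup>2) / a s) * of_real (y \<bullet> y)))"
    proof (cases "s \<in> {p..q}")
      case True
      have "(LINT x|lborel. K y x s) =
          h s * (LINT x|lborel. exp (- a s * of_real (x \<bullet> x) - 2 * of_real pi * \<i> * of_real (x \<bullet> y)))"
        using True by (simp add: K_def)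
      also have "\<dots> = h s * ((of_real pi / a s) ^ (DIM(real ^ 'd) div 2) * exp (- (of_real (pi\<^sup>2 * (y \<bullet> y)) / a s)))"
        by (subst integral_gaussian_fourier) (use assms pos[OF True] in auto)
      finally show ?thesis using True by (simp add: mult.assoc)
    qed (simp add: K_def)
  qed
  also have "\<dots> = exp_mixture p q (\<lambda>s. h s * (of_real pi / a s) ^ (CARD('d) div 2)) (\<lambda>s. of_real (pi\<^sup>2) / a s) (y \<bullet> y)"
  proof -
    have "continuous_on {p..q} (\<lambda>s. h s * (of_real pi / a s) ^ (CARD('d) div 2) *
        exp (- (of_real (pi\<^sup>2) / a s) * of_real (y \<bullet> y)))"
      using pos by (intro continuous_intros h' a') force+
    from set_borel_integral_eq_integral(2)[OF borel_integrable_atLeastAtMost'[OF this]]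
    show ?thesis
      by (simp add: set_lebesgue_integral_def exp_mixture_def)
  qed
  finally show "fourier_transform (\<lambda>x. exp_mixture p q h a (x \<bullet> x)) y =
      exp_mixture p q (\<lambda>s. h s * (of_real pi / a s) ^ (CARD('d) div 2)) (\<lambda>s. of_real (pi\<^sup>2) / a s) (y \<bullet> y)" .
qed

text \<open>\<open>Im g = (g - cnj g) / (2 \<i>)\<close>, and conjugating the function conjugates
  the transform and reflects its argument.\<close>

lemma fourier_transform_Im:
  assumes "integrable lborel g"
  shows "fourier_transform (\<lambda>x. of_real (Im (g x))) y =
    (fourier_transform g y - cnj (fourier_transform g (- y))) / (2 * \<i>)"
proof -
  define e where "e = (\<lambda>x. exp (- 2 * complex_of_real pi * \<i> * of_real (x \<bullet> y)))"
  have [measurable]: "g \<in> borel_measurable borel"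
    using borel_measurable_integrable[OF assms] by simp
  have [measurable]: "(\<lambda>x. cnj (g x)) \<in> borel_measurable borel"
    by (rule measurable_compose[where g = cnj and N = borel])
       (auto intro!: borel_measurable_continuous_onI continuous_intros)
  have [measurable]: "e \<in> borel_measurable borel"
    unfolding e_def by measurable
  have ne: "norm (e x) = 1" for x
    by (simp add: e_def)
  have int: "integrable lborel (\<lambda>x. g x * e x)" "integrable lborel (\<lambda>x. cnj (g x) * e x)"
    by (rule Bochner_Integration.integrable_bound[OF assms]; simp add: norm_mult ne)+
  have "cnj (fourier_transform g (- y)) = (LINT x|lborel. cnj (g x * exp (- 2 * complex_of_real pi * \<i> * of_real (x \<bullet> - y))))"
    unfolding fourier_transform_def by (rule Bochner_Integration.integral_cnj[symmetric])
  also have "\<dots> = (LINT x|lborel. cnj (g x) * e x)"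
    by (simp add: e_def exp_cnj)
  finally have "fourier_transform g y - cnj (fourier_transform g (- y)) =
      (LINT x|lborel. g x * e x - cnj (g x) * e x)"
    using int by (simp add: fourier_transform_def e_def)
  also have "\<dots> = (LINT x|lborel. (2 * \<i>) * (of_real (Im (g x)) * e x))"
    by (intro Bochner_Integration.integral_cong refl) (simp add: left_diff_distrib[symmetric] complex_diff_cnj)
  also have "\<dots> = (2 * \<i>) * fourier_transform (\<lambda>x. of_real (Im (g x))) y"
    by (simp add: fourier_transform_def e_def)
  finally show ?thesis by simp
qed

subsection \<open>The function with prescribed zeros\<close>

lemma has_integral_exp_ii:
  fixes k :: real
  assumes "p \<le> q" "k \<noteq> 0"
  shows "((\<lambda>s. exp (\<i> * of_real (k * s))) has_integral
      exp (\<i> * of_real (k * q)) / (\<i> * of_real k) - exp (\<i> * of_real (k * p)) / (\<i> * of_real k)) {p..q}"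
proof (rule fundamental_theorem_of_calculus[OF assms(1)])
  show "((\<lambda>s. exp (\<i> * of_real (k * s)) / (\<i> * of_real k)) has_vector_derivative exp (\<i> * of_real (k * s)))
      (at s within {p..q})" for s
  proof -
    have "((\<lambda>z. exp (\<i> * (of_real k * z)) / (\<i> * of_real k)) has_field_derivative
        exp (\<i> * (of_real k * of_real s))) (at (of_real s))"
      using assms(2) by (auto intro!: derivative_eq_intros simp: field_simps)
    from has_vector_derivative_real_field[OF this] show ?thesis
      by simp
  qed
qed

text \<open>The antiderivative comes from integration by parts. This integral enters because
  differentiating the superposition in \<open>t\<close> brings down a factor containing
  \<open>s\<close>.\<close>

lemma has_integral_ident_exp_ii:
  fixes k :: real
  assumes "p \<le> q" "k \<noteq> 0"
  shows "((\<lambda>s. of_real s * exp (\<i> * of_real (k * s))) has_integral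
      (of_real q / (\<i> * of_real k) + 1 / (of_real k)\<^sup>2) * exp (\<i> * of_real (k * q)) -
      (of_real p / (\<i> * of_real k) + 1 / (of_real k)\<^sup>2) * exp (\<i> * of_real (k * p))) {p..q}"
proof (rule fundamental_theorem_of_calculus[OF assms(1)])
  show "((\<lambda>s. (of_real s / (\<i> * of_real k) + 1 / (of_real k)\<^sup>2) * exp (\<i> * of_real (k * s))) has_vector_derivative
      of_real s * exp (\<i> * of_real (k * s))) (at s within {p..q})" for s
  proof -
    have "((\<lambda>z. (z / (\<i> * of_real k) + 1 / (of_real k)\<^sup>2) * exp (\<i> * (of_real k * z))) has_field_derivative
        of_real s * exp (\<i> * (of_real k * of_real s))) (at (of_real s))"
      using assms(2) by (auto intro!: derivative_eq_intros simp: field_simps power2_eq_square)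
    from has_vector_derivative_real_field[OF this] show ?thesis
      by simp
  qed
qed

lemma exp_ii_two_pi: "exp (\<i> * of_real (2 * real j * pi)) = 1"
proof -
  have "exp (\<i> * of_real (2 * real j * pi)) = exp (2 * of_nat j * of_real pi * \<i>)"
    by (simp add: mult_ac)
  also have "\<dots> = 1"
    using exp_integer_2pi[of "of_nat j"] by (simp add: mult_ac)
  finally show ?thesis .
qed

text \<open>The integrand is \<open>exp (- \<pi> t) exp (i s (t - 2))\<close>.\<close>

abbreviation "wave_weight \<equiv> \<lambda>s. exp (- 2 * \<i> * of_real s)"
abbreviation "wave_rate \<equiv> \<lambda>s. of_real pi - \<i> * of_real s"

text \<open>With \<open>I\<close> and \<open>J\<close> the integrals of \<open>w s\<close> and
  \<open>s * w s\<close> over \<open>{0..pi}\<close>, the superposition is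
  \<open>exp (- pi t) I\<close> and its derivative is \<open>exp (- pi t) (- pi I + \<i> J)\<close>.
  Hence only \<open>Im I\<close> and \<open>Re J\<close> matter.\<close>

lemma
  shows Im_wave_zero: "Im (exp_mixture 0 pi wave_weight wave_rate (2 * real (Suc j))) = 0"
    and Im_wave_deriv: "Im (exp_mixture 0 pi (\<lambda>s. - wave_rate s * wave_weight s) wave_rate (2 * real (Suc j))) =
      (if j = 0 then exp (- 2 * pi) * (pi\<^sup>2 / 2) else 0)"
proof -
  define t where "t = 2 * real (Suc j)"
  \<comment> \<open>\<open>k = t - 2\<close> is the frequency left after the weight has shifted
    \<open>t\<close> by 2. Counting with \<open>Suc j\<close> starts at \<open>t = 2\<close>, so
    \<open>j = 0\<close> is exactly the case without oscillation.\<close>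
  define k where "k = 2 * real j"
  define w where "w = (\<lambda>s. exp (\<i> * complex_of_real (k * s)))"
  have ww: "wave_weight s * exp (- wave_rate s * of_real t) = of_real (exp (- (pi * t))) * w s" for s
    unfolding w_def exp_of_real[symmetric] exp_add[symmetric]
    by (rule arg_cong[where f = exp]) (simp add: t_def k_def algebra_simps)
  have I: "\<exists>I J. (w has_integral I) {0..pi} \<and> ((\<lambda>s. of_real s * w s) has_integral J) {0..pi} \<and>
      Im I = 0 \<and> Re J = (if j = 0 then pi\<^sup>2 / 2 else 0)"
  proof (cases "j = 0")
    case True
    then have w1: "w = (\<lambda>_. 1)" by (simp add: w_def k_def)
    have I: "(w has_integral of_real pi) {0..pi}"
      unfolding w1 using has_integral_const_real[of "1 :: complex" 0 pi] by (simp add: scaleR_conv_of_real)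
    have "((\<lambda>s. complex_of_real s) has_integral of_real (pi\<^sup>2 / 2)) {0..pi}"
      by (rule has_integral_eq_rhs[OF has_integral_of_real[OF ident_has_integral]]) auto
    then have J: "((\<lambda>s. of_real s * w s) has_integral of_real (pi\<^sup>2 / 2)) {0..pi}"
      unfolding w1 by simp
    show ?thesis
      by (rule exI, rule exI, intro conjI, rule I, rule J) (simp_all add: True)
  next
    case False
    then have k: "k \<noteq> 0" by (simp add: k_def)
    have e: "exp (\<i> * complex_of_real (k * pi)) = 1"
      unfolding k_def by (rule exp_ii_two_pi)
    \<comment> \<open>For \<open>j \<noteq> 0\<close> the interval holds \<open>j\<close> full
      periods of \<open>w\<close>, so \<open>I\<close> vanishes; only the boundary term
      \<open>pi / (\<i> k)\<close> survives in \<open>J\<close>, and it is purely imaginary.\<close>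
    have I: "(w has_integral 0) {0..pi}"
      unfolding w_def by (rule has_integral_eq_rhs[OF has_integral_exp_ii[OF _ k]]) (simp_all only: e pi_ge_zero, simp)
    have J: "((\<lambda>s. of_real s * w s) has_integral of_real pi / (\<i> * of_real k)) {0..pi}"
      unfolding w_def
      by (rule has_integral_eq_rhs[OF has_integral_ident_exp_ii[OF _ k]]) (simp_all only: e pi_ge_zero, simp)
    show ?thesis
      by (rule exI, rule exI, intro conjI, rule I, rule J) (simp_all add: False Re_divide)
  qed
  then obtain I J where IJ: "(w has_integral I) {0..pi}" "((\<lambda>s. of_real s * w s) has_integral J) {0..pi}"
    "Im I = 0" "Re J = (if j = 0 then pi\<^sup>2 / 2 else 0)" by blast
  have "exp_mixture 0 pi wave_weight wave_rate t = of_real (exp (- (pi * t))) * I"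
    unfolding exp_mixture_def ww using IJ(1) by (intro integral_unique has_integral_mult_right)
  then show "Im (exp_mixture 0 pi wave_weight wave_rate (2 * real (Suc j))) = 0"
    using IJ(3) by (simp add: t_def)
  have "((\<lambda>s. of_real (exp (- (pi * t))) * (- of_real pi * w s + \<i> * (of_real s * w s))) has_integral
      of_real (exp (- (pi * t))) * (- of_real pi * I + \<i> * J)) {0..pi}"
    by (intro has_integral_mult_right has_integral_add IJ)
  also have "(\<lambda>s. of_real (exp (- (pi * t))) * (- of_real pi * w s + \<i> * (of_real s * w s))) =
      (\<lambda>s. (- wave_rate s * wave_weight s) * exp (- wave_rate s * of_real t))"
  proof
    fix s
    have "(- wave_rate s * wave_weight s) * exp (- wave_rate s * of_real t) =
        - wave_rate s * (wave_weight s * exp (- wave_rate s * of_real t))"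
      by (rule mult.assoc)
    then show "of_real (exp (- (pi * t))) * (- of_real pi * w s + \<i> * (of_real s * w s)) =
        (- wave_rate s * wave_weight s) * exp (- wave_rate s * of_real t)"
      unfolding ww by (simp add: algebra_simps)
  qed
  finally have "exp_mixture 0 pi (\<lambda>s. - wave_rate s * wave_weight s) wave_rate t =
      of_real (exp (- (pi * t))) * (- of_real pi * I + \<i> * J)"
    unfolding exp_mixture_def by (rule integral_unique)
  then show "Im (exp_mixture 0 pi (\<lambda>s. - wave_rate s * wave_weight s) wave_rate (2 * real (Suc j))) =
      (if j = 0 then exp (- 2 * pi) * (pi\<^sup>2 / 2) else 0)"
    using IJ(3,4) by (simp add: t_def mult.commute)
qed

section \<open>Assembly of \<open>f\<close>, its two parts and the index
  \<open>n = 1\<close>\<close>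

theorem theorem1p1:
  assumes "CARD('d::finite) mod 4 = 0"
  shows "\<exists>(f :: real ^ 'd \<Rightarrow> real) (fp :: real ^ 'd \<Rightarrow> complex)
           (fm :: real ^ 'd \<Rightarrow> complex) (n :: nat).
     radial f \<and> schwartz f \<and> radial fp \<and> schwartz fp \<and> radial fm \<and> schwartz fm \<and>
     (\<forall>x. complex_of_real (f x) = fp x + fm x) \<and>
     (\<forall>x. fourier_transform (\<lambda>t. complex_of_real (f t)) x =
            (- \<i>) powi (- (int CARD('d) div 2)) * (fp x - fm x)) \<and>
     radial_profile f (sqrt (2 * real n)) = 0 \<and>
     radial_deriv f (sqrt (2 * real n)) \<noteq> 0 \<and>
     (\<forall>m>n. radial_profile f (sqrt (2 * real m)) = 0 \<and>
            radial_deriv f (sqrt (2 * real m)) = 0)"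
proof -
  define W where "W = exp_mixture 0 pi wave_weight wave_rate"
  define W' where "W' = exp_mixture 0 pi (\<lambda>s. - wave_rate s * wave_weight s) wave_rate"
  define V where "V = exp_mixture 0 pi (\<lambda>s. wave_weight s * (of_real pi / wave_rate s) ^ (CARD('d) div 2))
      (\<lambda>s. of_real (pi\<^sup>2) / wave_rate s)"
  define c where "c = (- \<i>) powi (- (int CARD('d) div 2))"
  define F where "F = (\<lambda>t. Im (W t))"
  \<comment> \<open>\<open>P\<close> and \<open>N\<close> solve \<open>F = P + N\<close> and
    \<open>Im V = c (P - N)\<close>, where \<open>Im V\<close> will be the transform of
    \<open>F\<close>; the solution \<open>(F \<plusminus> c Im V) / 2\<close> relies on
    \<open>c * c = 1\<close>.\<close>
  define P where "P = (\<lambda>t. complex_of_real (Im (W t)) / 2 + c * (of_real (Im (V t)) / 2))"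
  define N where "N = (\<lambda>t. complex_of_real (Im (W t)) / 2 - c * (of_real (Im (V t)) / 2))"
  obtain q where q: "CARD('d) = 4 * q"
    using assms by (metis dvdE mod_0_imp_dvd)
  \<comment> \<open>Since \<open>d / 2 = 2 q\<close> is even and the square of \<open>- \<i>\<close>
    is -1, the constant \<open>c\<close> is a sign.\<close>
  have "int CARD('d) div 2 = int (2 * q)" by (simp add: q)
  then have "c = inverse ((-1) ^ q)"
    unfolding c_def by (simp only: power_int_minus power_int_of_nat power_mult) simp
  then have cc: "c * c = 1"
    by (simp add: power_inverse[symmetric] flip: power_mult_distrib)
  have rate: "wave_rate s \<noteq> 0" "Re (of_real (pi\<^sup>2) / wave_rate s) > 0" for s :: real
  proof -
    have "Re (wave_rate s) \<noteq> 0" by simp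
    then show *: "wave_rate s \<noteq> 0" by (metis zero_complex.simps(1))
    \<comment> \<open>The real part is \<open>pi^3 / (pi^2 + s^2)\<close>, so the transformed
      Gaussians decay too.\<close>
    show "Re (of_real (pi\<^sup>2) / wave_rate s) > 0"
      unfolding Re_divide by (simp add: add_pos_nonneg)
  qed
  have cont: "continuous_on A wave_weight" "continuous_on A wave_rate" for A
    by (intro continuous_intros)+
  have W: "schwartz_profile W"
    unfolding W_def by (rule schwartz_profile_exp_mixture[OF _ cont]) auto
  have V: "schwartz_profile V"
    unfolding V_def
  proof (rule schwartz_profile_exp_mixture)
    show "continuous_on {0..pi} (\<lambda>s. wave_weight s * (of_real pi / wave_rate s) ^ (CARD('d) div 2))"
      using rate(1) by (intro continuous_intros) simp_all
    show "continuous_on {0..pi} (\<lambda>s. of_real (pi\<^sup>2) / wave_rate s)"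
      using rate(1) by (intro continuous_intros) simp_all
  qed (use rate in auto)
  have F: "schwartz_profile F"
    unfolding F_def by (rule schwartz_profile_bounded_linear[OF bounded_linear_Im W])
  \<comment> \<open>Taking an imaginary part and scaling is real-linear, so \<open>b = 1\<close>
    serves the \<open>W\<close> term and \<open>b = c\<close> or \<open>b = - c\<close> the
    \<open>V\<close> term.\<close>
  have half: "bounded_linear (\<lambda>z. b * (complex_of_real (Im z) / 2))" for b
    by (intro bounded_linear_const_mult bounded_linear_divide[THEN bounded_linear_compose]
          bounded_linear_of_real[THEN bounded_linear_compose] bounded_linear_Im)
  have P: "schwartz_profile P"
    unfolding P_def
    using schwartz_profile_add[OF schwartz_profile_bounded_linear[OF half[of 1] W]
        schwartz_profile_bounded_linear[OF half[of c] V]] by simp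
  have N: "schwartz_profile N"
    unfolding N_def
    using schwartz_profile_add[OF schwartz_profile_bounded_linear[OF half[of 1] W]
        schwartz_profile_bounded_linear[OF half[of "- c"] V]] by simp
  have "fourier_transform (\<lambda>x :: real ^ 'd. of_real (F (x \<bullet> x))) y = of_real (Im (V (y \<bullet> y)))" for y
  proof -
    have FT: "fourier_transform (\<lambda>x :: real ^ 'd. W (x \<bullet> x)) y = V (y \<bullet> y)" for y
      unfolding W_def V_def
      by (rule fourier_transform_exp_mixture[OF _ cont]) (use q in auto)
    have int: "integrable lborel (\<lambda>x :: real ^ 'd. W (x \<bullet> x))"
      unfolding W_def by (rule integrable_exp_mixture[OF _ cont]) (use q in auto)
    show ?thesis
      unfolding F_def fourier_transform_Im[OF int] FT
      by (simp add: complex_diff_cnj complex_eq_iff)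
  qed
  moreover have "P t - N t = c * of_real (Im (V t))" for t
    by (simp add: P_def N_def)
  ultimately have FT: "fourier_transform (\<lambda>x :: real ^ 'd. complex_of_real (F (x \<bullet> x))) y =
      c * (P (y \<bullet> y) - N (y \<bullet> y))" for y
    using cc by (simp add: mult.assoc[symmetric])
  have PN: "complex_of_real (F t) = P t + N t" for t
    by (simp add: F_def P_def N_def)
  have "(W has_vector_derivative W' t) (at t)" for t
    unfolding W_def W'_def by (rule exp_mixture_has_vector_derivative[OF cont])
  then have F': "(F has_vector_derivative Im (W' t)) (at t)" for t
    unfolding F_def by (rule bounded_linear.has_vector_derivative[OF bounded_linear_Im])
  have zero: "radial_profile (\<lambda>x :: real ^ 'd. F (x \<bullet> x)) (sqrt (2 * real (Suc j))) = 0" for j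
  proof -
    have "F (2 * real (Suc j)) = 0"
      unfolding F_def W_def by (rule Im_wave_zero)
    then show ?thesis
      using radial_profile_inner_self[where G = F and r = "sqrt (2 * real (Suc j))"]
      by (simp del: of_nat_Suc)
  qed
  \<comment> \<open>The chain rule factor \<open>2 r\<close> is nonzero at these radii, so the
    radial derivative vanishes exactly when the derivative of \<open>F\<close> does.\<close>
  have deriv: "radial_deriv (\<lambda>x :: real ^ 'd. F (x \<bullet> x)) (sqrt (2 * real (Suc j))) =
      2 * sqrt (2 * real (Suc j)) * (if j = 0 then exp (- 2 * pi) * (pi\<^sup>2 / 2) else 0)" for j
    using radial_deriv_inner_self[OF _ F', of "sqrt (2 * real (Suc j))"] Im_wave_deriv[of j]
    by (simp add: W'_def del: of_nat_Suc)
  show ?thesis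
  proof (intro exI conjI allI impI)
    show "radial (\<lambda>x :: real ^ 'd. F (x \<bullet> x))" "radial (\<lambda>x :: real ^ 'd. P (x \<bullet> x))"
      "radial (\<lambda>x :: real ^ 'd. N (x \<bullet> x))"
      by (rule radial_inner_self)+
    show "schwartz (\<lambda>x :: real ^ 'd. F (x \<bullet> x))" "schwartz (\<lambda>x :: real ^ 'd. P (x \<bullet> x))"
      "schwartz (\<lambda>x :: real ^ 'd. N (x \<bullet> x))"
      by (rule schwartz_profile_imp_schwartz, fact)+
    show "complex_of_real (F (x \<bullet> x)) = P (x \<bullet> x) + N (x \<bullet> x)" for x :: "real ^ 'd"
      by (rule PN)
    show "fourier_transform (\<lambda>x :: real ^ 'd. complex_of_real (F (x \<bullet> x))) x =
        (- \<i>) powi (- (int CARD('d) div 2)) * (P (x \<bullet> x) - N (x \<bullet> x))" for x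
      using FT unfolding c_def .
    \<comment> \<open>Here \<open>n\<close> is instantiated to 1, so the simple zero sits at
      \<open>sqrt 2\<close>, which is the case \<open>j = 0\<close> above.\<close>
    show "radial_profile (\<lambda>x :: real ^ 'd. F (x \<bullet> x)) (sqrt (2 * real 1)) = 0"
      using zero[of 0] by simp
    show "radial_deriv (\<lambda>x :: real ^ 'd. F (x \<bullet> x)) (sqrt (2 * real 1)) \<noteq> 0"
      using deriv[of 0] by simp
    fix m :: nat assume "1 < m"
    then obtain j where "m = Suc j" "j \<noteq> 0" by (cases m) auto
    then show "radial_profile (\<lambda>x :: real ^ 'd. F (x \<bullet> x)) (sqrt (2 * real m)) = 0"
      "radial_deriv (\<lambda>x :: real ^ 'd. F (x \<bullet> x)) (sqrt (2 * real m)) = 0"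
      using zero[of j] deriv[of j] by simp_all
  qed
qed

end
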